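(* If $a\in\mathbb{R}$ and $K\subseteq\mathbb{R}^{\mathbb{N}}$ is a Borel set with $\gamma_\infty(K)>0$, then for $\gamma_\infty$-a.e. $y\in\mathbb{R}^{\mathbb{N}}$, $$\gamma_\infty\big(\sqrt{1+a^2}\,K+a y\big)>0.$$
   Context: $\gamma_\infty$ is the product measure on $\mathbb{R}^{\mathbb{N}}$ (with the product topology) arising from the standard Gaussian measure on $\mathbb{R}$ (mean $0$, variance $1$) in each coordinate. For $c\in\mathbb{R}$, $v\in\mathbb{R}^{\mathbb{N}}$ and $K\subseteq\mathbb{R}^{\mathbb{N}}$, $cK+v=\{cx+v:x\in K\}$. *)

theory Defs
  imports "HOL-Probability.Probability"
begin

definition gauss :: "real measure" where
  "gauss = density lborel (\<lambda>x. ennreal (std_normal_density x))"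

definition gauss_inf :: "(nat \<Rightarrow> real) measure" where
  "gauss_inf = PiM UNIV (\<lambda>_. gauss)"

definition affine_image :: "real \<Rightarrow> (nat \<Rightarrow> real) \<Rightarrow> (nat \<Rightarrow> real) set \<Rightarrow> (nat \<Rightarrow> real) set" where
  "affine_image c v K = (\<lambda>x i. c * x i + v i) ` K"

text \<open>\<^term>\<open>emeasure\<close> returns 0 on non-measurable sets. The next lemmas show that
  \<^const>\<open>gauss_inf\<close> is a measure on exactly the Borel sets of the product topology.\<close>

lemma sets_gauss_inf: "sets gauss_inf = sets borel"
proof -
  have "sets gauss_inf = sets (PiM UNIV (\<lambda>_::nat. borel :: real measure))"
    unfolding gauss_inf_def by (rule sets_PiM_cong) (simp_all add: gauss_def)
  then show ?thesis by (simp add: sets_PiM_equal_borel)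
qed

lemma prob_space_gauss_inf: "prob_space gauss_inf"
  unfolding gauss_inf_def gauss_def
  by (intro prob_space_PiM prob_space_normal_density) simp

end

theory Submission
  imports Defs
begin

text \<open>
  Let \<open>c = sqrt (1 + a\<^sup>2)\<close> and let \<open>A\<close> be the set of \<open>y\<close> for which \<open>c K + a y\<close> has positive
  measure. If \<open>x\<close> and \<open>y\<close> are independent with law \<open>\<gamma>\<close>, then \<open>(x - a y) / c\<close> again has law
  \<open>\<gamma>\<close>; by Fubini the average over \<open>y\<close> of the measure of \<open>c K + a y\<close> is \<open>\<gamma>(K) > 0\<close>, so
  \<open>A\<close> is not null. The Gaussian measure on the line has the same null sets as Lebesgue
  measure, hence translating a single coordinate preserves the null sets of \<open>\<gamma>\<close>. Therefore
  changing one coordinate of \<open>y\<close> does not affect membership in \<open>A\<close>, which makes \<open>A\<close> a tail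
  event, and Kolmogorov's 0-1 law gives \<open>\<gamma>(A) = 1\<close>.
\<close>

section \<open>Infinite product measures: gluing and independence of coordinates\<close>

text \<open>Both measures agree on finite-dimensional boxes: a box over \<open>J\<close> splits into
  a box over its \<open>Inl\<close> part times a box over its \<open>Inr\<close> part. This turns
  two independent sequences into one independent family indexed by a sum type.\<close>

lemma distr_pair_PiM_case_sum:
  fixes M :: "'i + 'j \<Rightarrow> 'a measure"
  assumes M: "\<And>s. prob_space (M s)"
  shows "distr (PiM UNIV (\<lambda>i. M (Inl i)) \<Otimes>\<^sub>M PiM UNIV (\<lambda>j. M (Inr j))) (PiM UNIV M)
    (\<lambda>(x, y). case_sum x y) = PiM UNIV M" (is "distr (?L \<Otimes>\<^sub>M ?R) ?P ?f = ?P")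
proof (rule measure_eqI_PiM_infinite[symmetric, OF refl])
  interpret P: prob_space ?P by (intro prob_space_PiM M)
  interpret R: prob_space ?R by (intro prob_space_PiM M)
  show "finite_measure ?P" by unfold_locales
  have comp: "(\<lambda>z. (case z of (x, y) \<Rightarrow> case_sum x y) s) \<in> measurable (?L \<Otimes>\<^sub>M ?R) (M s)" for s
    by (cases s) (simp_all add: split_beta')
  have f: "?f \<in> measurable (?L \<Otimes>\<^sub>M ?R) ?P"
    using comp by (rule measurable_PiM_single'[where f="\<lambda>s z. (case z of (x, y) \<Rightarrow> case_sum x y) s"])
      (use measurable_space[OF comp] in auto)
  fix F :: "'i + 'j \<Rightarrow> 'a set" and J
  assume J: "finite J" and F: "\<And>s. s \<in> J \<Longrightarrow> F s \<in> sets (M s)"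
  define J1 J2 where "J1 = Inl -` J" and "J2 = Inr -` J"
  have J_eq: "J = J1 <+> J2"
    unfolding J1_def J2_def by (auto simp: Plus_def image_iff) (metis sum.exhaust)
  have fin: "finite J1" "finite J2"
    using J by (auto simp: J1_def J2_def intro: finite_vimageI)
  have ball_Plus: "(\<forall>s\<in>J1 <+> J2. Q s) \<longleftrightarrow> (\<forall>i\<in>J1. Q (Inl i)) \<and> (\<forall>j\<in>J2. Q (Inr j))" for Q
    by auto
  let ?E1 = "prod_emb UNIV (\<lambda>i. M (Inl i)) J1 (\<Pi>\<^sub>E i\<in>J1. F (Inl i))"
  let ?E2 = "prod_emb UNIV (\<lambda>j. M (Inr j)) J2 (\<Pi>\<^sub>E j\<in>J2. F (Inr j))"
  have "?P (prod_emb UNIV M J (Pi\<^sub>E J F)) = (\<Prod>s\<in>J. M s (F s))"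
    using J F by (intro emeasure_PiM_emb M) auto
  also have "\<dots> = (\<Prod>i\<in>J1. M (Inl i) (F (Inl i))) * (\<Prod>j\<in>J2. M (Inr j) (F (Inr j)))"
    unfolding J_eq using fin by (simp add: prod.Plus)
  also have "\<dots> = ?L ?E1 * ?R ?E2"
    using fin F by (intro arg_cong2[where f="(*)"] emeasure_PiM_emb[symmetric] M) (auto simp: J_eq)
  also have "\<dots> = (?L \<Otimes>\<^sub>M ?R) (?E1 \<times> ?E2)"
    using fin F by (intro R.emeasure_pair_measure_Times[symmetric] sets_PiM_I) (auto simp: J_eq)
  also have "?E1 \<times> ?E2 = ?f -` prod_emb UNIV M J (Pi\<^sub>E J F) \<inter> space (?L \<Otimes>\<^sub>M ?R)"
    by (auto simp: prod_emb_def space_pair_measure space_PiM PiE_iff J_eq split_sum_all ball_Plus)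
  also have "(?L \<Otimes>\<^sub>M ?R) \<dots> = distr (?L \<Otimes>\<^sub>M ?R) ?P ?f (prod_emb UNIV M J (Pi\<^sub>E J F))"
    using J F by (intro emeasure_distr[symmetric] f sets_PiM_I) auto
  finally show "?P (prod_emb UNIV M J (Pi\<^sub>E J F))
    = distr (?L \<Otimes>\<^sub>M ?R) ?P ?f (prod_emb UNIV M J (Pi\<^sub>E J F))" .
qed simp

text \<open>The coordinate map is the identity, so the joint law of the coordinates is
  \<open>PiM UNIV M\<close> itself, the product of their marginals \<open>M i\<close>.\<close>

lemma indep_vars_PiM_components:
  assumes M: "\<And>i. prob_space (M i)"
  shows "prob_space.indep_vars (PiM UNIV M) M (\<lambda>i x. x i) UNIV"
proof -
  interpret prob_space "PiM UNIV M" by (intro prob_space_PiM M)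
  show ?thesis
    by (subst indep_vars_iff_distr_eq_PiM) (auto simp: distr_PiM_component M restrict_UNIV)
qed

section \<open>Gaussian null sets and translation of one coordinate\<close>

lemma prob_space_gauss: "prob_space gauss"
  unfolding gauss_def by (intro prob_space_normal_density) simp

lemma sets_gauss [measurable_cong, simp]: "sets gauss = sets borel"
  by (simp add: gauss_def)

lemma space_gauss [simp]: "space gauss = UNIV"
  by (simp add: gauss_def)

lemma space_gauss_inf [simp]: "space gauss_inf = UNIV"
  by (simp add: gauss_inf_def space_PiM)

lemma sets_gauss_inf_PiM [measurable_cong]: "sets gauss_inf = sets (PiM UNIV (\<lambda>_. borel))"
  by (simp add: sets_gauss_inf sets_PiM_equal_borel)

text \<open>The normal density is strictly positive everywhere.\<close>

lemma AE_gauss_iff: "(AE x in gauss. P x) \<longleftrightarrow> (AE x in lborel. P x)"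
  unfolding gauss_def by (simp add: AE_density normal_density_pos)

lemma AE_gauss_shift:
  assumes "Measurable.pred borel P" and "AE x in gauss. P x"
  shows "AE x in gauss. P (x + t)"
  using AE_borel_affine[of 1 P t] assms by (simp add: AE_gauss_iff add.commute)

text \<open>Replacing coordinate \<open>i\<close> by an independent Gaussian sample does not change
  the law; Fubini then isolates that coordinate while the others stay fixed.\<close>

lemma AE_gauss_inf_fun_upd_iff:
  assumes [measurable]: "Measurable.pred (PiM UNIV (\<lambda>_. borel)) P"
  shows "(AE x in gauss_inf. P x) \<longleftrightarrow> (AE x in gauss_inf. AE s in gauss. P (x(i := s)))"
proof -
  interpret G: prob_space gauss by (rule prob_space_gauss)
  interpret S: prob_space gauss_inf by (rule prob_space_gauss_inf)
  interpret pair_sigma_finite gauss gauss_inf ..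
  have f [measurable]: "(\<lambda>(s, x). x(i := s)) \<in> measurable (gauss \<Otimes>\<^sub>M gauss_inf) gauss_inf"
    unfolding gauss_inf_def split_beta'
    by (rule measurable_fun_upd[where J=UNIV]) auto
  have "(\<lambda>z. (snd z)(i := fst z)) \<in> measurable (gauss \<Otimes>\<^sub>M gauss_inf) (PiM UNIV (\<lambda>_. borel))"
    using f by (simp add: split_beta' measurable_cong_sets[OF refl sets_gauss_inf_PiM])
  then have P_f: "{z \<in> space (gauss \<Otimes>\<^sub>M gauss_inf). P ((snd z)(i := fst z))} \<in> sets (gauss \<Otimes>\<^sub>M gauss_inf)"
    by (intro predE measurable_compose[OF _ assms])
  \<comment> \<open>Here \<open>i\<close> already lies in the index set \<open>UNIV\<close>, so the
    update overwrites the old coordinate instead of adding a new one.\<close>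
  have "gauss_inf = distr (gauss \<Otimes>\<^sub>M gauss_inf) gauss_inf (\<lambda>(s, x). x(i := s))"
    using distr_pair_PiM_eq_PiM[of UNIV "\<lambda>_. gauss" i] prob_space_gauss
    by (simp add: gauss_inf_def)
  then have "(AE x in gauss_inf. P x)
      \<longleftrightarrow> (AE x in distr (gauss \<Otimes>\<^sub>M gauss_inf) gauss_inf (\<lambda>(s, x). x(i := s)). P x)"
    by (rule arg_cong)
  also have "\<dots> \<longleftrightarrow> (AE z in gauss \<Otimes>\<^sub>M gauss_inf. P ((snd z)(i := fst z)))"
    using assms by (subst AE_distr_iff) (simp_all add: split_beta' pred_def space_PiM sets_gauss_inf_PiM)
  also have "\<dots> \<longleftrightarrow> (AE s in gauss. AE x in gauss_inf. P (x(i := s)))"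
    by (rule AE_pair_iff[OF P_f, symmetric])
  also have "\<dots> \<longleftrightarrow> (AE x in gauss_inf. AE s in gauss. P (x(i := s)))"
    by (rule AE_commute[OF P_f])
  finally show ?thesis .
qed

text \<open>With the other coordinates frozen, this is translation invariance of null sets on the
  line.\<close>

lemma AE_gauss_inf_shift:
  assumes [measurable]: "Measurable.pred (PiM UNIV (\<lambda>_. borel)) P"
    and "AE x in gauss_inf. P x"
  shows "AE x in gauss_inf. P (x(i := x i + t))"
proof -
  have upd [measurable]: "(\<lambda>x. x(i := g x)) \<in> measurable (PiM UNIV (\<lambda>_. borel)) (PiM UNIV (\<lambda>_. borel))"
    if [measurable]: "g \<in> borel_measurable (PiM UNIV (\<lambda>_. borel))" for g :: "(nat \<Rightarrow> real) \<Rightarrow> real"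
    by (rule measurable_fun_upd[where J=UNIV]) auto
  have upd': "(\<lambda>s. x(i := s)) \<in> measurable borel (PiM UNIV (\<lambda>_. borel))" for x :: "nat \<Rightarrow> real"
    by (rule measurable_fun_upd[where J=UNIV]) (auto simp: space_PiM)
  have "AE x in gauss_inf. AE s in gauss. P (x(i := s))"
    using assms by (simp add: AE_gauss_inf_fun_upd_iff[symmetric])
  then have "AE x in gauss_inf. AE s in gauss. P (x(i := s + t))"
  proof (rule eventually_mono)
    fix x assume "AE s in gauss. P (x(i := s))"
    then show "AE s in gauss. P (x(i := s + t))"
      by (rule AE_gauss_shift[rotated]) (rule measurable_compose[OF upd' assms(1)])
  qed
  \<comment> \<open>Putting \<open>x(i := s)\<close> for \<open>x\<close> turns
    \<open>P (x(i := x i + t))\<close> into \<open>P (x(i := s + t))\<close>.\<close>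
  then show ?thesis
    by (subst AE_gauss_inf_fun_upd_iff[where i=i]) simp_all
qed

section \<open>Normalized linear combinations of independent Gaussian sequences\<close>

text \<open>Each coordinate is normal with mean 0 and variance
  \<open>(1 + a\<^sup>2) / c\<^sup>2 = 1\<close>, and distinct coordinates use disjoint pairs of
  independent inputs. The joint law is therefore again the product.\<close>

lemma distr_gauss_inf_lincomb:
  fixes a c :: real
  assumes c: "c > 0" "c\<^sup>2 = 1 + a\<^sup>2"
  shows "distr (gauss_inf \<Otimes>\<^sub>M gauss_inf) gauss_inf (\<lambda>(y, x) i. (x i - a * y i) / c) = gauss_inf"
proof -
  let ?Q = "gauss_inf \<Otimes>\<^sub>M gauss_inf"
  interpret S: prob_space gauss_inf by (rule prob_space_gauss_inf)
  interpret SS: pair_prob_space gauss_inf gauss_inf ..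
  \<comment> \<open>One family holds all inputs: \<open>Inl i\<close> gives coordinate
    \<open>i\<close> of \<open>y\<close>, \<open>Inr i\<close> that of \<open>x\<close>.\<close>
  let ?V = "\<lambda>s (z :: (nat \<Rightarrow> real) \<times> (nat \<Rightarrow> real)). case_sum (fst z) (snd z) s"
  let ?P = "PiM UNIV (\<lambda>_ :: nat + nat. gauss)"
  let ?Z = "\<lambda>i (z :: (nat \<Rightarrow> real) \<times> (nat \<Rightarrow> real)). (snd z i - a * fst z i) / c"
  have V_meas [measurable]: "?V s \<in> measurable ?Q gauss" for s
    by (cases s) (simp_all add: gauss_inf_def)
  have VP: "(\<lambda>z s. ?V s z) \<in> measurable ?Q ?P"
    by (rule measurable_PiM_single') auto
  have distr_P: "distr ?Q ?P (\<lambda>z s. ?V s z) = ?P"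
    using distr_pair_PiM_case_sum[of "\<lambda>_ :: nat + nat. gauss"] prob_space_gauss
    by (simp add: gauss_inf_def split_beta')
  have distr_V: "distr ?Q gauss (?V s) = gauss" for s
  proof -
    have "distr ?Q gauss (?V s) = distr (distr ?Q ?P (\<lambda>z s. ?V s z)) gauss (\<lambda>w. w s)"
      by (subst distr_distr[OF _ VP]) (simp_all add: comp_def)
    then show ?thesis
      by (simp add: distr_P distr_PiM_component[of UNIV "\<lambda>_. gauss" s] prob_space_gauss)
  qed
  have indep_V: "SS.indep_vars (\<lambda>_. gauss) ?V UNIV"
    by (subst SS.indep_vars_iff_distr_eq_PiM) (auto simp: distr_V distr_P restrict_UNIV)
  have normal_V: "distributed ?Q lborel (?V s) std_normal_density" for s
  proof -
    have "distr ?Q lborel (?V s) = distr ?Q gauss (?V s)"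
      by (rule distr_cong) auto
    then show ?thesis
      using V_meas[of s] measurable_cong_sets[OF refl sets_gauss, of ?Q]
      by (simp add: distributed_def distr_V) (simp add: gauss_def)
  qed
  have indep_pair: "SS.indep_var borel (?V (Inr i)) borel (\<lambda>z. a * ?V (Inl i) z)" for i
  proof -
    have "SS.indep_var (PiM {Inr i} (\<lambda>_. gauss)) (\<lambda>z. restrict (\<lambda>s. ?V s z) {Inr i})
        (PiM {Inl i} (\<lambda>_. gauss)) (\<lambda>z. restrict (\<lambda>s. ?V s z) {Inl i})"
      by (rule SS.indep_var_restrict[OF indep_V]) auto
    then have "SS.indep_var borel ((\<lambda>w. w (Inr i)) \<circ> (\<lambda>z. restrict (\<lambda>s. ?V s z) {Inr i}))
        borel ((\<lambda>w. a * w (Inl i)) \<circ> (\<lambda>z. restrict (\<lambda>s. ?V s z) {Inl i}))"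
      by (rule SS.indep_var_compose) measurable
    then show ?thesis by (simp add: comp_def)
  qed
  have distr_Z: "distr ?Q gauss (?Z i) = gauss" for i
  proof -
    have diff: "distributed ?Q lborel (\<lambda>z. ?V (Inr i) z - a * ?V (Inl i) z) (normal_density 0 c)"
    \<comment> \<open>For \<open>a = 0\<close> the variable scaled by \<open>a\<close> is constant
      and has no density, so the rule for differences of normals needs \<open>a\<close>
      nonzero.\<close>
    proof (cases "a = 0")
      case True
      then have "c = 1" using c by (simp add: power2_eq_1_iff)
      then show ?thesis using normal_V[of "Inr i"] True by simp
    next
      case False
      have "distributed ?Q lborel (\<lambda>z. 0 + a * ?V (Inl i) z) (normal_density (0 + a * 0) (\<bar>a\<bar> * 1))"
        using False by (intro SS.normal_density_affine normal_V) auto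
      then have "distributed ?Q lborel (\<lambda>z. ?V (Inr i) z - a * ?V (Inl i) z)
          (normal_density (0 - 0) (sqrt (1\<^sup>2 + \<bar>a\<bar>\<^sup>2)))"
        using False by (intro SS.diff_indep_normal indep_pair normal_V) auto
      moreover have "sqrt (1\<^sup>2 + \<bar>a\<bar>\<^sup>2) = c"
        using c by (simp add: real_sqrt_unique)
      ultimately show ?thesis by simp
    qed
    then have "distributed ?Q lborel (\<lambda>z. (?V (Inr i) z - a * ?V (Inl i) z - 0) / c) std_normal_density"
      by (rule SS.normal_standard_normal_convert[OF c(1), THEN iffD1])
    then have "distr ?Q lborel (?Z i) = gauss"
      by (simp add: distributed_def gauss_def)
    moreover have "distr ?Q lborel (?Z i) = distr ?Q gauss (?Z i)"
      by (rule distr_cong) auto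
    ultimately show ?thesis by simp
  qed
  have indep_Z: "SS.indep_vars (\<lambda>_. gauss) ?Z UNIV"
  proof -
    \<comment> \<open>The blocks \<open>{Inl i, Inr i}\<close> are pairwise disjoint, hence
      independent, and \<open>?Z i\<close> is a function of block \<open>i\<close> alone.\<close>
    have "SS.indep_vars (\<lambda>i. PiM {Inl i, Inr i} (\<lambda>_. gauss))
        (\<lambda>i z. restrict (\<lambda>s. ?V s z) {Inl i, Inr i}) UNIV"
      by (rule SS.indep_vars_restrict[OF indep_V]) (auto simp: disjoint_family_on_def)
    then have "SS.indep_vars (\<lambda>_. gauss)
        (\<lambda>i z. (\<lambda>w. (w (Inr i) - a * w (Inl i)) / c) (restrict (\<lambda>s. ?V s z) {Inl i, Inr i})) UNIV"
      by (rule SS.indep_vars_compose2) measurable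
    then show ?thesis by simp
  qed
  then have "distr ?Q gauss_inf (\<lambda>z i. ?Z i z) = PiM UNIV (\<lambda>i. distr ?Q gauss (?Z i))"
    by (subst (asm) SS.indep_vars_iff_distr_eq_PiM) (auto simp: restrict_UNIV gauss_inf_def)
  then show ?thesis
    by (simp add: distr_Z split_beta' flip: gauss_inf_def)
qed

text \<open>For nonzero \<open>c\<close> the affine map is a bijection with the displayed inverse.
  As a preimage, the set becomes accessible to measurability and Fubini arguments.\<close>

lemma affine_image_eq_vimage:
  assumes "c \<noteq> 0"
  shows "affine_image c v K = (\<lambda>x i. (x i - v i) / c) -` K"
proof safe
  fix x assume "(\<lambda>i. (x i - v i) / c) \<in> K"
  then show "x \<in> affine_image c v K"
    using assms by (auto simp: affine_image_def intro!: image_eqI[where x="\<lambda>i. (x i - v i) / c"])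
qed (use assms in \<open>auto simp: affine_image_def\<close>)

text \<open>Invariance makes \<open>A\<close> its own preimage under the map that sets the first
  \<open>n\<close> coordinates to 0. This map sees only the coordinates from \<open>n\<close> on, so
  \<open>A\<close> is a tail event.\<close>

lemma gauss_inf_0_1_law:
  assumes A: "A \<in> sets gauss_inf"
    and invariant: "\<And>y i t. y(i := t) \<in> A \<longleftrightarrow> y \<in> A"
  shows "measure gauss_inf A = 0 \<or> measure gauss_inf A = 1"
proof -
  interpret S: prob_space gauss_inf by (rule prob_space_gauss_inf)
  let ?C = "\<lambda>i. {(\<lambda>y :: nat \<Rightarrow> real. y i) -` B | B. B \<in> sets borel}"
  \<comment> \<open>Finitely many one-coordinate changes, one per induction step, zero out the first
    \<open>n\<close> coordinates.\<close>
  have zero: "(\<lambda>i. if i < n then 0 else y i) \<in> A \<longleftrightarrow> y \<in> A" for y n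
  proof (induction n)
    case (Suc n)
    have "(\<lambda>i. if i < Suc n then 0 else y i) = (\<lambda>i. if i < n then 0 else y i)(n := 0)"
      by (auto simp: fun_eq_iff)
    then show ?case using Suc invariant by simp
  qed simp
  show ?thesis
  proof (rule S.kolmogorov_0_1_law)
    show "sigma_algebra (space gauss_inf) (sigma_sets UNIV (?C i))" for i
      by (simp add: sigma_algebra_sigma_sets)
    have "S.indep_vars (\<lambda>_. gauss) (\<lambda>i y. y i) UNIV"
      using indep_vars_PiM_components[of "\<lambda>_. gauss"] prob_space_gauss
      by (simp add: gauss_inf_def)
    then show "S.indep_sets (\<lambda>i. sigma_sets UNIV (?C i)) UNIV"
      by (simp add: S.indep_vars_def)
    show "A \<in> S.tail_events (\<lambda>i. sigma_sets UNIV (?C i))"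
      unfolding S.tail_events_def
    proof safe
      fix n
      let ?T = "sigma UNIV (\<Union>i\<in>{n..}. sigma_sets UNIV (?C i))"
      \<comment> \<open>Coordinates below \<open>n\<close> of the image are constant, the others are
        among the generators of \<open>?T\<close>.\<close>
      have "(\<lambda>y i. if i < n then 0 else y i) \<in> measurable ?T (PiM UNIV (\<lambda>_. borel :: real measure))"
      proof (rule measurable_PiM_single')
        fix i :: nat
        show "(\<lambda>y. if i < n then 0 else y i) \<in> borel_measurable ?T"
        proof (cases "i < n")
          case False
          then have "(\<lambda>y. y i) -` B \<inter> space ?T \<in> sets ?T" if "B \<in> sets borel" for B :: "real set"
            using that by (auto intro!: sigma_sets.Basic bexI[of _ i] exI)
          then show ?thesis using False by (auto intro!: measurableI)
        qed simp
      qed auto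
      then have "(\<lambda>y i. if i < n then 0 else y i) -` A \<inter> space ?T \<in> sets ?T"
        using A by (intro measurable_sets) (auto simp: sets_gauss_inf_PiM)
      moreover have "(\<lambda>y i. if i < n then 0 else y i) -` A = A"
        using zero by auto
      ultimately show "A \<in> sigma_sets (space gauss_inf) (\<Union>i\<in>{n..}. sigma_sets UNIV (?C i))"
        by simp
    qed
  qed
qed

section \<open>The set of translations giving positive measure has probability one\<close>

theorem theorem1p2:
  fixes a :: real and K :: "(nat \<Rightarrow> real) set"
  assumes "K \<in> sets borel"
    and "emeasure gauss_inf K > 0"
  shows "AE y in gauss_inf.
    emeasure gauss_inf (affine_image (sqrt (1 + a\<^sup>2)) (\<lambda>i. a * y i) K) > 0"
proof -
  interpret S: prob_space gauss_inf by (rule prob_space_gauss_inf)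
  interpret pair_sigma_finite gauss_inf gauss_inf ..
  define c where "c = sqrt (1 + a\<^sup>2)"
  have c: "c > 0" "c\<^sup>2 = 1 + a\<^sup>2"
    by (auto simp: c_def add_pos_nonneg)
  have K [measurable]: "K \<in> sets (PiM UNIV (\<lambda>_. borel))"
    using assms(1) by (simp add: sets_PiM_equal_borel)
  \<comment> \<open>\<open>?Z y\<close> inverts the map sending \<open>x\<close> to
    \<open>c x + a y\<close>, so \<open>?Z y x \<in> K\<close> says that \<open>x\<close> lies in
    the affine image of \<open>K\<close>.\<close>
  let ?Z = "\<lambda>y x i. (x i - a * y i) / c"
  have Z [measurable]: "(\<lambda>z. ?Z (fst z) (snd z)) \<in> measurable (gauss_inf \<Otimes>\<^sub>M gauss_inf) gauss_inf"
    unfolding measurable_cong_sets[OF refl sets_gauss_inf_PiM]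
    by (rule measurable_PiM_single') auto
  have Z': "?Z y \<in> measurable (PiM UNIV (\<lambda>_. borel)) (PiM UNIV (\<lambda>_. borel))" for y
    by (rule measurable_PiM_single') (auto simp: space_PiM)
  have Z_K: "{z \<in> space (gauss_inf \<Otimes>\<^sub>M gauss_inf). ?Z (fst z) (snd z) \<in> K} \<in> sets (gauss_inf \<Otimes>\<^sub>M gauss_inf)"
    using measurable_sets[OF Z, of K] assms(1)
    by (simp add: sets_gauss_inf vimage_def Int_def conj_commute)
  define f where "f y = emeasure gauss_inf (affine_image c (\<lambda>i. a * y i) K)" for y
  have f_eq: "f y = emeasure gauss_inf {x. ?Z y x \<in> K}" for y
    using c(1) by (simp add: f_def affine_image_eq_vimage vimage_def)
  have sets_Z: "{x. ?Z y x \<in> K} \<in> sets gauss_inf" for y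
    using measurable_sets[OF Z' K, of y] by (simp add: sets_gauss_inf_PiM vimage_def space_PiM)
  have f_zero_iff: "f y = 0 \<longleftrightarrow> (AE x in gauss_inf. ?Z y x \<notin> K)" for y
    unfolding f_eq using sets_Z[of y] by (subst AE_iff_measurable[OF _ refl]) auto
  define A where "A = {y. f y > 0}"
  have f_meas [measurable]: "f \<in> borel_measurable gauss_inf"
    unfolding f_eq[abs_def] using Z_K by (intro S.measurable_emeasure) auto
  have A: "A \<in> sets gauss_inf"
  proof -
    have "{y \<in> space gauss_inf. f y > 0} \<in> sets gauss_inf" by measurable
    then show ?thesis by (simp add: A_def)
  qed
  have shift: "f (y(i := t)) = 0" if "f y = 0" for y i t
  proof -
    \<comment> \<open>Changing \<open>y i\<close> to \<open>t\<close> has the same effect on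
      \<open>?Z\<close> as translating \<open>x i\<close> by \<open>a * (y i - t)\<close>, and such
      a translation preserves null sets.\<close>
    have "?Z y (x(i := x i + a * (y i - t))) = ?Z (y(i := t)) x" for x
      by (auto simp: fun_eq_iff algebra_simps)
    moreover have "Measurable.pred (PiM UNIV (\<lambda>_. borel)) (\<lambda>x. ?Z y x \<notin> K)"
      using measurable_compose[OF Z', of "\<lambda>x. x \<notin> K"] by simp
    ultimately show ?thesis
      using AE_gauss_inf_shift[of "\<lambda>x. ?Z y x \<notin> K" i "a * (y i - t)"] that
      by (simp add: f_zero_iff)
  qed
  have "y(i := t) \<in> A \<longleftrightarrow> y \<in> A" for y i t
    \<comment> \<open>The second instance restores the old value \<open>y i\<close>, which gives the
      converse direction.\<close>
    using shift[of y i t] shift[of "y(i := t)" i "y i"] by (auto simp: A_def zero_less_iff_neq_zero)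
  then have "measure gauss_inf A = 0 \<or> measure gauss_inf A = 1"
    by (rule gauss_inf_0_1_law[OF A])
  moreover have "measure gauss_inf A \<noteq> 0"
  proof
    assume "measure gauss_inf A = 0"
    then have "AE y in gauss_inf. y \<notin> A"
      using A by (subst AE_iff_measurable[OF A]) (auto simp: S.emeasure_eq_measure)
    \<comment> \<open>If \<open>A\<close> were null, almost every section would miss
      \<open>K\<close>. By Fubini \<open>?Z\<close> would avoid \<open>K\<close> almost surely, but
      \<open>?Z\<close> has law \<open>gauss_inf\<close>, so \<open>K\<close> would be null.\<close>
    then have "AE y in gauss_inf. AE x in gauss_inf. ?Z y x \<notin> K"
      by (simp add: A_def f_zero_iff)
    then have "AE z in gauss_inf \<Otimes>\<^sub>M gauss_inf. ?Z (fst z) (snd z) \<notin> K"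
      using sets.sets_Collect_neg[OF Z_K] by (subst (asm) AE_pair_iff) auto
    then have "AE x in distr (gauss_inf \<Otimes>\<^sub>M gauss_inf) gauss_inf (\<lambda>(y, x). ?Z y x). x \<notin> K"
      using Z sets.compl_sets[OF K]
      by (subst AE_distr_iff) (auto simp: split_beta' sets_gauss_inf_PiM space_PiM Compl_eq simp flip: Compl_eq_Diff_UNIV)
    then have "AE x in gauss_inf. x \<notin> K"
      unfolding distr_gauss_inf_lincomb[OF c] .
    then have "emeasure gauss_inf K = 0"
      by (subst (asm) AE_iff_measurable[where N=K]) (auto simp: sets_gauss_inf assms(1))
    with assms(2) show False by simp
  qed
  ultimately have "AE y in gauss_inf. y \<in> A"
    by (simp add: S.prob_eq_1[OF A])
  then show ?thesis
    by (simp add: A_def f_def c_def)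
qed

end
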